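(* Let $n,m$ be natural numbers and let $$F(x,y)=\sum_{i=0}^{n}\sum_{\substack{j=0\\ i+j>0}}^{m}\alpha_{ij}x^iy^j$$ with real coefficients $\alpha_{ij}$. For a natural number $k$ put $$\theta_k=\int_{\mathbb{R}^N}\left|\int_0^1\!\!\int_0^1 e^{2\pi i F(x,y)}\,dx\,dy\right|^{2k}\prod_{\substack{0\le i\le n,\ 0\le j\le m\\ i+j>0}}d\alpha_{ij},\qquad N=(n+1)(m+1)-1 .$$ Then the integral $\theta_k$ diverges for all integers $k$ such that $$4k\le 2+\frac{(n+m)(n+1)(m+1)}{2}.$$
   Context: $\theta_k$ is called the special (singular) integral of the two-dimensional Tarry problem; the outer integral is over all $N$ real coefficients $\alpha_{ij}$ ($0\le i\le n$, $0\le j\le m$, $i+j>0$) of the polynomial $F$. *)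

theory Defs
  imports "HOL-Analysis.Analysis"
begin

definition tarry_idx :: "nat \<Rightarrow> nat \<Rightarrow> (nat \<times> nat) set" where
  "tarry_idx n m = {(i, j). i \<le> n \<and> j \<le> m \<and> i + j > 0}"

definition tarry_poly ::
    "nat \<Rightarrow> nat \<Rightarrow> (nat \<times> nat \<Rightarrow> real) \<Rightarrow> real \<Rightarrow> real \<Rightarrow> real" where
  "tarry_poly n m \<alpha> x y = (\<Sum>(i, j)\<in>tarry_idx n m. \<alpha> (i, j) * x ^ i * y ^ j)"

definition tarry_osc :: "nat \<Rightarrow> nat \<Rightarrow> (nat \<times> nat \<Rightarrow> real) \<Rightarrow> complex" where
  "tarry_osc n m \<alpha> =
     (LINT y:{0..1}|lborel. (LINT x:{0..1}|lborel.
        exp (2 * complex_of_real pi * \<i> * complex_of_real (tarry_poly n m \<alpha> x y))))"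

(* The space of coefficients is modelled by the functions on the index set, with the
   product of one-dimensional Lebesgue measures; its dimension is card (tarry_idx n m),
   see card_tarry_idx.  The integrand is nonnegative, so the integral is taken with
   values in [0, \<infinity>] and divergence means that its value is \<infinity>. *)
definition tarry_theta :: "nat \<Rightarrow> nat \<Rightarrow> nat \<Rightarrow> ennreal" where
  "tarry_theta n m k =
     (\<integral>\<^sup>+ \<alpha>. ennreal (cmod (tarry_osc n m \<alpha>) ^ (2 * k)) \<partial>(\<Pi>\<^sub>M p\<in>tarry_idx n m. lborel))"

lemma tarry_idx_eq: "tarry_idx n m = ({0..n} \<times> {0..m}) - {(0, 0)}"
  by (auto simp: tarry_idx_def)

lemma finite_tarry_idx [simp]: "finite (tarry_idx n m)"
  by (simp add: tarry_idx_eq)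

lemma card_tarry_idx: "card (tarry_idx n m) = (n + 1) * (m + 1) - 1"
  by (simp add: tarry_idx_eq card_Diff_singleton)

end

(* No asymptotics of oscillatory integrals are needed.  Averaging over the coefficients against
   a Gaussian of width 1/e, whose Fourier transform is positive, bounds theta_k from below by a
   constant times e^(-N) times the measure of the pairs of k-tuples of points of the square
   whose power sums (sum of x^i y^j) all agree up to e.  Fix a dyadic interval [c, c + d) and
   k-tuples with all x in it.  The sums of (x - c)^i y^j lie in a box of volume about d^A, where
   A = (m + 1) n (n + 1) / 2, so by Cauchy-Schwarz over the cells of side e the pairs coming
   from this interval have measure at least about d^(2k) e^N / d^A.  Summing over the 1/d
   intervals gives d^(2k - 1 - A) e^N.  If 2k <= A + 1 the scales d = 2^(-r), r < L,
   contribute about L e^N in total, so theta_k is larger than a constant times L for every L.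
   Exchanging x and y one may take n >= m, and then 4k <= 2 + (n + m) (n + 1) (m + 1) / 2
   implies 2k <= A + 1. *)
theory Submission
  imports Defs "HOL-Probability.Probability"
begin

section \<open>Gaussian averaging over the coefficients\<close>

text \<open>The substitution \<open>b = e * a\<close> reduces both claims to the characteristic
  function of the standard normal distribution. Because the value is a positive real, contributions
  from outside a chosen set of phases can later be discarded.\<close>

lemma gaussian_fourier:
  fixes e t :: real
  assumes e: "e > 0"
  shows "integrable lborel (\<lambda>a. complex_of_real (exp (- (e * a)\<^sup>2 / 2)) * iexp (a * t))" (is ?int)
    and "(\<integral>a. complex_of_real (exp (- (e * a)\<^sup>2 / 2)) * iexp (a * t) \<partial>lborel)
      = complex_of_real (sqrt (2 * pi) / e * exp (- (t / e)\<^sup>2 / 2))" (is ?eq)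
proof -
  let ?g = "\<lambda>b. std_normal_density b *\<^sub>R iexp (t / e * b)"
  interpret real_distribution std_normal_distribution by (rule real_dist_normal_dist)
  have "integrable std_normal_distribution (\<lambda>b. iexp (t / e * b))"
    by (rule integrable_iexp) auto
  then have g: "integrable lborel ?g"
    by (subst (asm) integrable_density) auto
  have "(\<integral>b. ?g b \<partial>lborel) = char std_normal_distribution (t / e)"
    unfolding char_def by (subst integral_density) auto
  then have gi: "(\<integral>b. ?g b \<partial>lborel) = complex_of_real (exp (- (t / e)\<^sup>2 / 2))"
    by (simp add: char_std_normal_distribution)
  have *: "complex_of_real (exp (- (e * a)\<^sup>2 / 2)) * iexp (a * t) = complex_of_real (sqrt (2 * pi)) * ?g (0 + e * a)" for a
    using e by (simp add: std_normal_density_def scaleR_conv_of_real field_simps)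
  have ge: "integrable lborel (\<lambda>a. ?g (0 + e * a))"
    using g e by (subst lborel_integrable_real_affine_iff) auto
  have "(\<integral>b. ?g b \<partial>lborel) = e *\<^sub>R (\<integral>a. ?g (0 + e * a) \<partial>lborel)"
    using e by (subst lborel_integral_real_affine[where c = e and t = 0]) auto
  with gi e have gei: "(\<integral>a. ?g (0 + e * a) \<partial>lborel) = complex_of_real (exp (- (t / e)\<^sup>2 / 2) / e)"
    by (simp add: scaleR_conv_of_real field_simps)
  show ?int unfolding * by (intro integrable_mult_right ge)
  show ?eq unfolding * integral_mult_right_zero gei by simp
qed

text \<open>The square is the integral times its conjugate, and Fubini makes this one integral over
  pairs. For a unimodular \<open>f\<close> the integrand is the exponential of a phase
  difference.\<close>

lemma norm_integral_square:
  fixes f :: "'z \<Rightarrow> complex"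
  assumes "prob_space Z" and f: "integrable Z f"
  shows "complex_of_real ((cmod (\<integral>z. f z \<partial>Z))\<^sup>2) = (\<integral>v. f (fst v) * cnj (f (snd v)) \<partial>(Z \<Otimes>\<^sub>M Z))"
proof -
  interpret prob_space Z by fact
  interpret pair_sigma_finite Z Z ..
  have [measurable]: "f \<in> borel_measurable Z" using f by auto
  have [measurable]: "cnj \<in> borel_measurable borel"
    by (intro borel_measurable_continuous_onI continuous_intros)
  have "integrable (Z \<Otimes>\<^sub>M Z) (\<lambda>v. f (fst v) * cnj (f (snd v)))"
  proof (rule Fubini_integrable)
    show "integrable Z (\<lambda>x. \<integral>y. norm (f (fst (x, y)) * cnj (f (snd (x, y)))) \<partial>Z)"
      using f by (simp add: norm_mult)
  qed (use f in auto)
  then have "(\<integral>v. f (fst v) * cnj (f (snd v)) \<partial>(Z \<Otimes>\<^sub>M Z)) = (\<integral>x. \<integral>y. f x * cnj (f y) \<partial>Z \<partial>Z)"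
    by (subst integral_fst'[symmetric]) auto
  also have "\<dots> = (\<integral>z. f z \<partial>Z) * cnj (\<integral>z. f z \<partial>Z)"
    by simp
  finally show ?thesis by (simp only: complex_norm_square)
qed

lemma iexp_sum: "finite I \<Longrightarrow> iexp (\<Sum>p\<in>I. f p) = (\<Prod>p\<in>I. iexp (f p))"
  by (simp add: sum_distrib_left exp_sum)

lemma cnj_iexp: "cnj (iexp x) = iexp (- x)"
  by (simp add: exp_cnj)

text \<open>A Gaussian weight, at most 1, only lowers the integral and makes Fubini applicable.
  Integrating over \<alpha> first leaves a product of positive Gaussians in the differences
  \<open>T p (fst v) - T p (snd v)\<close>. It is kept only where all differences are at most
  \<open>e\<close>, and there each factor is at least
  \<open>sqrt (2 * pi) * exp (- 1 / 2) / e\<close>.\<close>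

lemma nn_integral_oscillatory_square_ge:
  fixes T :: "'i \<Rightarrow> 'z \<Rightarrow> real"
  assumes I: "finite I" and "prob_space Z" and T: "\<And>p. p \<in> I \<Longrightarrow> T p \<in> borel_measurable Z"
    and e: "e > 0"
  shows "ennreal ((sqrt (2 * pi) * exp (- 1 / 2) / e) ^ card I *
      measure (Z \<Otimes>\<^sub>M Z) {v \<in> space (Z \<Otimes>\<^sub>M Z). \<forall>p\<in>I. \<bar>T p (fst v) - T p (snd v)\<bar> \<le> e})
    \<le> (\<integral>\<^sup>+ \<alpha>. ennreal ((cmod (\<integral>z. iexp (\<Sum>p\<in>I. \<alpha> p * T p z) \<partial>Z))\<^sup>2) \<partial>(\<Pi>\<^sub>M p\<in>I. lborel))"
proof -
  interpret Z: prob_space Z by fact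
  interpret ZZ: prob_space "Z \<Otimes>\<^sub>M Z" using assms by (simp add: prob_space_pair)
  interpret L: product_sigma_finite "\<lambda>_ :: 'i. lborel :: real measure" ..
  interpret P: sigma_finite_measure "\<Pi>\<^sub>M p\<in>I. (lborel :: real measure)" by (rule L.sigma_finite) fact
  interpret PZ: pair_sigma_finite "\<Pi>\<^sub>M p\<in>I. (lborel :: real measure)" "Z \<Otimes>\<^sub>M Z" ..
  note T[measurable]
  let ?P = "\<Pi>\<^sub>M p\<in>I. (lborel :: real measure)"
  let ?d = "\<lambda>p v. T p (fst v) - T p (snd v)"
  let ?w = "\<lambda>\<alpha> :: 'i \<Rightarrow> real. \<Prod>p\<in>I. exp (- (e * \<alpha> p)\<^sup>2 / 2)"
  let ?J = "\<lambda>\<alpha>. \<integral>z. iexp (\<Sum>p\<in>I. \<alpha> p * T p z) \<partial>Z"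
  let ?f = "\<lambda>\<alpha> v. complex_of_real (?w \<alpha>) * iexp (\<Sum>p\<in>I. \<alpha> p * ?d p v)"
  let ?C = "sqrt (2 * pi) * exp (- 1 / 2) / e"
  let ?G = "{v \<in> space (Z \<Otimes>\<^sub>M Z). \<forall>p\<in>I. \<bar>?d p v\<bar> \<le> e}"
  have w0: "0 \<le> ?w \<alpha>" for \<alpha> by (intro prod_nonneg) auto
  have w1: "?w \<alpha> \<le> 1" for \<alpha> by (intro prod_le_1) auto
  have w: "integrable ?P ?w"
    using gaussian_fourier(1)[OF e, of 0, THEN integrable_norm]
    by (intro L.product_integrable_prod I) (simp add: norm_mult)
  have [measurable]: "?w \<in> borel_measurable ?P" using w by auto
  have J_int: "integrable Z (\<lambda>z. iexp (\<Sum>p\<in>I. \<alpha> p * T p z))" for \<alpha>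
    by (rule Z.integrable_const_bound[where B = 1]) auto
  have J: "complex_of_real ((cmod (?J \<alpha>))\<^sup>2) = (\<integral>v. iexp (\<Sum>p\<in>I. \<alpha> p * ?d p v) \<partial>(Z \<Otimes>\<^sub>M Z))" for \<alpha>
    unfolding norm_integral_square[OF \<open>prob_space Z\<close> J_int] cnj_iexp
    by (simp add: exp_add[symmetric] right_diff_distrib sum_subtractf)
  have f_meas: "(\<lambda>(\<alpha>, v). ?f \<alpha> v) \<in> borel_measurable (?P \<Otimes>\<^sub>M (Z \<Otimes>\<^sub>M Z))"
    using I by measurable
  have f_int: "integrable (?P \<Otimes>\<^sub>M (Z \<Otimes>\<^sub>M Z)) (\<lambda>(\<alpha>, v). ?f \<alpha> v)"
  proof (rule PZ.Fubini_integrable)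
    \<comment> \<open>The modulus of \<open>?f \<alpha> v\<close> is \<open>?w \<alpha>\<close> for
      every \<open>v\<close>, so on the probability space of pairs absolute integrability reduces to
      that of the weight.\<close>
    show "integrable ?P (\<lambda>\<alpha>. \<integral>v. norm (case (\<alpha>, v) of (\<alpha>, v) \<Rightarrow> ?f \<alpha> v) \<partial>(Z \<Otimes>\<^sub>M Z))"
      using w w0 by (simp add: norm_mult ZZ.prob_space flip: prod_norm)
    show "AE \<alpha> in ?P. integrable (Z \<Otimes>\<^sub>M Z) (\<lambda>v. case (\<alpha>, v) of (\<alpha>, v) \<Rightarrow> ?f \<alpha> v)"
    proof (rule AE_I2)
      fix \<alpha>
      show "integrable (Z \<Otimes>\<^sub>M Z) (\<lambda>v. case (\<alpha>, v) of (\<alpha>, v) \<Rightarrow> ?f \<alpha> v)"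
        using w1[of \<alpha>] w0[of \<alpha>] I
        by (intro ZZ.integrable_const_bound[where B = 1]) (auto simp: norm_mult simp flip: prod_norm)
    qed
  qed (fact f_meas)
  have inner: "(\<integral>\<alpha>. ?f \<alpha> v \<partial>?P) = complex_of_real (\<Prod>p\<in>I. sqrt (2 * pi) / e * exp (- (?d p v / e)\<^sup>2 / 2))" for v
  proof -
    \<comment> \<open>Weight and phase both split over the coordinates, so the integral over
      \<alpha> is a product of one-dimensional Gaussian transforms.\<close>
    have "?f \<alpha> v = (\<Prod>p\<in>I. complex_of_real (exp (- (e * \<alpha> p)\<^sup>2 / 2)) * iexp (\<alpha> p * ?d p v))" for \<alpha>
      unfolding iexp_sum[OF I] by (simp add: prod.distrib)
    then show ?thesis
      unfolding of_real_prod gaussian_fourier(2)[OF e, symmetric]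
      by (simp only:) (intro L.product_integral_prod I gaussian_fourier(1)[OF e])
  qed
  \<comment> \<open>Both orders of integration give real numbers, so Fubini for the complex
    \<open>?f\<close> becomes an identity between real integrals.\<close>
  have outer: "complex_of_real (\<integral>\<alpha>. ?w \<alpha> * (cmod (?J \<alpha>))\<^sup>2 \<partial>?P)
      = complex_of_real (\<integral>v. (\<Prod>p\<in>I. sqrt (2 * pi) / e * exp (- (?d p v / e)\<^sup>2 / 2)) \<partial>(Z \<Otimes>\<^sub>M Z))"
    using PZ.Fubini_integral[OF f_int]
    unfolding inner integral_complex_of_real integral_mult_right_zero J[symmetric]
    by (simp del: of_real_prod flip: of_real_mult of_real_power)
  have wJ_int: "integrable ?P (\<lambda>\<alpha>. ?w \<alpha> * (cmod (?J \<alpha>))\<^sup>2)"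
    using PZ.integrable_fst[OF f_int]
    unfolding integral_mult_right_zero J[symmetric] of_real_mult[symmetric] complex_of_real_integrable_eq .
  have prod_le: "prod f I \<ge> ?C ^ card I" if "\<And>p. p \<in> I \<Longrightarrow> f p \<ge> ?C" for f :: "'i \<Rightarrow> real"
    using prod_mono[of I "\<lambda>_. ?C" f] that e by auto
  have "?C ^ card I * measure (Z \<Otimes>\<^sub>M Z) ?G = (\<integral>v. ?C ^ card I * indicator ?G v \<partial>(Z \<Otimes>\<^sub>M Z))"
    using I by simp
  also have "\<dots> \<le> (\<integral>v. (\<Prod>p\<in>I. sqrt (2 * pi) / e * exp (- (?d p v / e)\<^sup>2 / 2)) \<partial>(Z \<Otimes>\<^sub>M Z))"
  proof (rule integral_mono)
    show "integrable (Z \<Otimes>\<^sub>M Z) (\<lambda>v. ?C ^ card I * indicator ?G v)"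
      using I by (intro integrable_mult_right integrable_real_indicator) (auto simp: less_top[symmetric])
    show "integrable (Z \<Otimes>\<^sub>M Z) (\<lambda>v. \<Prod>p\<in>I. sqrt (2 * pi) / e * exp (- (?d p v / e)\<^sup>2 / 2))"
      using PZ.integrable_snd[OF f_int] unfolding inner complex_of_real_integrable_eq .
    fix v assume "v \<in> space (Z \<Otimes>\<^sub>M Z)"
    show "?C ^ card I * indicator ?G v \<le> (\<Prod>p\<in>I. sqrt (2 * pi) / e * exp (- (?d p v / e)\<^sup>2 / 2))"
    proof (cases "v \<in> ?G")
      case True
      have "?C \<le> sqrt (2 * pi) / e * exp (- (?d p v / e)\<^sup>2 / 2)" if "p \<in> I" for p
      proof -
        have "\<bar>?d p v / e\<bar> \<le> 1" using True that e by (auto simp: field_simps)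
        then have "(?d p v / e)\<^sup>2 \<le> 1" by (simp add: abs_square_le_1)
        then have "exp (- 1 / 2) \<le> exp (- (?d p v / e)\<^sup>2 / 2)" by simp
        then have "sqrt (2 * pi) / e * exp (- 1 / 2) \<le> sqrt (2 * pi) / e * exp (- (?d p v / e)\<^sup>2 / 2)"
          using e by (intro mult_left_mono) auto
        then show ?thesis by (simp only: times_divide_eq_left)
      qed
      then show ?thesis using True by (simp only: indicator_simps mult_1_right) (rule prod_le)
    next
      case False
      then show ?thesis using e by (auto intro!: prod_nonneg)
    qed
  qed
  also have "\<dots> = (\<integral>\<alpha>. ?w \<alpha> * (cmod (?J \<alpha>))\<^sup>2 \<partial>?P)"
    using outer by (simp only: of_real_eq_iff)
  finally have "ennreal (?C ^ card I * measure (Z \<Otimes>\<^sub>M Z) ?G) \<le> ennreal (\<integral>\<alpha>. ?w \<alpha> * (cmod (?J \<alpha>))\<^sup>2 \<partial>?P)"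
    by (rule ennreal_leI)
  also have "\<dots> = (\<integral>\<^sup>+\<alpha>. ennreal (?w \<alpha> * (cmod (?J \<alpha>))\<^sup>2) \<partial>?P)"
    using w0 by (intro nn_integral_eq_integral[symmetric] wJ_int AE_I2) auto
  also have "\<dots> \<le> (\<integral>\<^sup>+\<alpha>. ennreal ((cmod (?J \<alpha>))\<^sup>2) \<partial>?P)"
    using w0 w1 by (intro nn_integral_mono ennreal_leI mult_left_le_one_le) auto
  finally show ?thesis .
qed

section \<open>Cauchy-Schwarz over cells\<close>

text \<open>Cut each \<open>E s\<close> into the level sets of \<open>g s\<close>. The squares of
  these cells are disjoint subsets of \<open>G\<close>, so their measures add up, and Cauchy-Schwarz
  over the \<open>card (B s)\<close> labels bounds the sum of squared cell measures from
  below.\<close>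

lemma measure_pair_ge_sum_cells:
  assumes "prob_space Z" and S: "finite S" "disjoint_family_on E S"
    and E: "\<And>s. s \<in> S \<Longrightarrow> E s \<in> sets Z"
    and B: "\<And>s. s \<in> S \<Longrightarrow> finite (B s)" "\<And>s z. s \<in> S \<Longrightarrow> z \<in> E s \<Longrightarrow> g s z \<in> B s"
    and g: "\<And>s b. s \<in> S \<Longrightarrow> b \<in> B s \<Longrightarrow> {z \<in> E s. g s z = b} \<in> sets Z"
    and G: "G \<in> sets (Z \<Otimes>\<^sub>M Z)"
    and close: "\<And>s z z'. s \<in> S \<Longrightarrow> z \<in> E s \<Longrightarrow> z' \<in> E s \<Longrightarrow> g s z = g s z' \<Longrightarrow> (z, z') \<in> G"
  shows "(\<Sum>s\<in>S. (measure Z (E s))\<^sup>2 / card (B s)) \<le> measure (Z \<Otimes>\<^sub>M Z) G"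
proof -
  interpret Z: prob_space Z by fact
  interpret ZZ: prob_space "Z \<Otimes>\<^sub>M Z" using assms by (simp add: prob_space_pair)
  define D where "D = (\<lambda>(s, b). {z \<in> E s. g s z = b})"
  have D: "D p \<in> sets Z" if "p \<in> Sigma S B" for p
    using that g by (auto simp: D_def)
  have "(measure Z (E s))\<^sup>2 / card (B s) \<le> (\<Sum>b\<in>B s. (measure Z (D (s, b)))\<^sup>2)" if s: "s \<in> S" for s
  \<comment> \<open>For an empty \<open>B s\<close> the quotient is 0 by the convention for division
    by zero.\<close>
  proof (cases "B s = {}")
    case False
    have "E s = (\<Union>b\<in>B s. D (s, b))" using B(2)[OF s] by (auto simp: D_def)
    then have "measure Z (E s) = measure Z (\<Union>b\<in>B s. D (s, b))" by (rule arg_cong)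
    also have "\<dots> = (\<Sum>b\<in>B s. measure Z (D (s, b)))"
    proof (rule Z.finite_measure_finite_Union)
      show "finite (B s)" using B(1) s .
      show "(\<lambda>b. D (s, b)) ` B s \<subseteq> sets Z" using s D by auto
      show "disjoint_family_on (\<lambda>b. D (s, b)) (B s)" by (auto simp: disjoint_family_on_def D_def)
    qed
    finally show ?thesis
      using sum_squared_le_sum_of_squares[of "\<lambda>b. measure Z (D (s, b))" "B s"] False B(1)[OF s]
      by (simp add: field_simps card_gt_0_iff)
  qed simp
  then have "(\<Sum>s\<in>S. (measure Z (E s))\<^sup>2 / card (B s)) \<le> (\<Sum>s\<in>S. \<Sum>b\<in>B s. (measure Z (D (s, b)))\<^sup>2)"
    by (rule sum_mono)
  also have "\<dots> = (\<Sum>p\<in>Sigma S B. (measure Z (D p))\<^sup>2)"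
    using S B by (subst sum.Sigma) auto
  also have "\<dots> = (\<Sum>p\<in>Sigma S B. measure (Z \<Otimes>\<^sub>M Z) (D p \<times> D p))"
    using D by (intro sum.cong refl) (simp add: measure_def Z.emeasure_pair_measure_Times enn2real_mult power2_eq_square)
  also have "\<dots> = measure (Z \<Otimes>\<^sub>M Z) (\<Union>p\<in>Sigma S B. D p \<times> D p)"
  proof (rule ZZ.finite_measure_finite_Union[symmetric])
    show "finite (Sigma S B)" using S B by auto
    \<comment> \<open>For different \<open>s\<close> the cells lie in disjoint sets
      \<open>E s\<close>; for the same \<open>s\<close> they carry different labels.\<close>
    show "disjoint_family_on (\<lambda>p. D p \<times> D p) (Sigma S B)"
      using S(2) by (fastforce simp: disjoint_family_on_def D_def)
  qed (use D in auto)
  also have "\<dots> \<le> measure (Z \<Otimes>\<^sub>M Z) G"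
    using close by (intro ZZ.finite_measure_mono G) (auto simp: D_def)
  finally show ?thesis .
qed

section \<open>Close power sums over dyadic intervals\<close>

text \<open>Expanding \<open>((X l - a) + a) ^ i\<close> expresses a power sum through the shifted
  sums of order up to \<open>i\<close>. As \<open>0 \<le> a \<le> 1\<close>, the coefficients are at
  most binomial coefficients, with total \<open>2 ^ i\<close>. So cells can be formed from sums
  centred at the end of a short interval, which lie in a small box, while closeness is obtained for
  the plain power sums.\<close>

lemma power_sum_diff_le_shifted:
  fixes X Y X' Y' :: "nat \<Rightarrow> real"
  assumes a: "0 \<le> a" "a \<le> 1"
    and close: "\<And>s. s \<le> i \<Longrightarrow>
      \<bar>(\<Sum>l<k. (X l - a) ^ s * Y l ^ j) - (\<Sum>l<k. (X' l - a) ^ s * Y' l ^ j)\<bar> \<le> \<eta>"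
  shows "\<bar>(\<Sum>l<k. X l ^ i * Y l ^ j) - (\<Sum>l<k. X' l ^ i * Y' l ^ j)\<bar> \<le> 2 ^ i * \<eta>"
proof -
  let ?S = "\<lambda>X Y s. \<Sum>l<k. (X l - a) ^ s * Y l ^ j"
  have expand: "(\<Sum>l<k. X l ^ i * Y l ^ j) = (\<Sum>s\<le>i. real (i choose s) * a ^ (i - s) * ?S X Y s)"
    for X Y :: "nat \<Rightarrow> real"
  proof -
    have "X l ^ i = (\<Sum>s\<le>i. real (i choose s) * (X l - a) ^ s * a ^ (i - s))" for l
      using binomial_ring[of "X l - a" a i] by simp
    then have "(\<Sum>l<k. X l ^ i * Y l ^ j)
        = (\<Sum>l<k. \<Sum>s\<le>i. real (i choose s) * a ^ (i - s) * ((X l - a) ^ s * Y l ^ j))"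
      by (simp add: sum_distrib_left sum_distrib_right mult_ac)
    also have "\<dots> = (\<Sum>s\<le>i. real (i choose s) * a ^ (i - s) * ?S X Y s)"
      by (subst sum.swap) (simp add: sum_distrib_left)
    finally show ?thesis .
  qed
  have "\<bar>(\<Sum>l<k. X l ^ i * Y l ^ j) - (\<Sum>l<k. X' l ^ i * Y' l ^ j)\<bar>
      = \<bar>\<Sum>s\<le>i. real (i choose s) * a ^ (i - s) * (?S X Y s - ?S X' Y' s)\<bar>"
    unfolding expand by (simp add: right_diff_distrib sum_subtractf)
  also have "\<dots> \<le> (\<Sum>s\<le>i. real (i choose s) * \<eta>)"
  proof (rule order_trans[OF sum_abs sum_mono])
    fix s assume "s \<in> {..i}"
    then have "a ^ (i - s) * \<bar>?S X Y s - ?S X' Y' s\<bar> \<le> 1 * \<eta>"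
      using a close[of s] by (intro mult_mono power_le_one) auto
    then have "real (i choose s) * (a ^ (i - s) * \<bar>?S X Y s - ?S X' Y' s\<bar>) \<le> real (i choose s) * \<eta>"
      by (intro mult_left_mono) auto
    then show "\<bar>real (i choose s) * a ^ (i - s) * (?S X Y s - ?S X' Y' s)\<bar> \<le> real (i choose s) * \<eta>"
      using a by (simp add: abs_mult mult.assoc)
  qed
  also have "\<dots> = 2 ^ i * \<eta>"
    by (simp add: choose_row_sum flip: sum_distrib_right of_nat_sum)
  finally show ?thesis .
qed

text \<open>The midpoint \<open>(c + 1 / 2) / 2 ^ r\<close> separates \<open>x\<close> from
  \<open>y\<close>. For \<open>r < r'\<close> it is a grid point of the finer scale, yet it would
  lie strictly inside the finer dyadic interval that contains both points.\<close>

lemma dyadic_split_unique: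
  fixes x y :: real
  assumes "x \<in> {c / 2 ^ r..<(c + 1 / 2) / 2 ^ r}" "y \<in> {(c + 1 / 2) / 2 ^ r..<(c + 1) / 2 ^ r}"
    and "x \<in> {c' / 2 ^ r'..<(c' + 1 / 2) / 2 ^ r'}" "y \<in> {(c' + 1 / 2) / 2 ^ r'..<(c' + 1) / 2 ^ r'}"
    and "c \<in> \<int>" "c' \<in> \<int>"
  shows "r = r'"
  using assms
proof (induction r r' arbitrary: c c' rule: linorder_wlog)
  case (le r r')
  show ?case
  proof (rule ccontr)
    assume "r \<noteq> r'"
    with le obtain t where t: "r' = r + 1 + t"
      by (metis Suc_eq_plus1 add.assoc le_neq_implies_less less_iff_Suc_add plus_1_eq_Suc)
    obtain d d' :: int where d: "c = of_int d" "c' = of_int d'"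
      using le by (auto elim!: Ints_cases)
    have "c' / 2 ^ r' < (c + 1 / 2) / 2 ^ r" "(c + 1 / 2) / 2 ^ r < (c' + 1) / 2 ^ r'"
      using le.prems(1-4) by auto
    moreover have "(c + 1 / 2) / 2 ^ r = of_int ((2 * d + 1) * 2 ^ t) / 2 ^ r'"
      by (simp add: d t power_add field_simps)
    ultimately have "of_int d' < (of_int ((2 * d + 1) * 2 ^ t) :: real)"
      "(of_int ((2 * d + 1) * 2 ^ t) :: real) < of_int (d' + 1)"
      unfolding d by (simp_all add: divide_less_cancel)
    then show False by (simp only: of_int_less_iff)
  qed
next
  case (sym r r')
  then show ?case by metis
qed

text \<open>At scale \<open>r\<close> there are \<open>2 ^ r\<close> intervals. Each set
  \<open>E (r, c)\<close> of tuples has measure \<open>(1 / 2 ^ (r + 1)) ^ k\<close>, and its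
  centred power sums meet at most
  \<open>((k + 1) / \<eta>) ^ card I * (1 / 2 ^ r) ^ sum fst I\<close> cells of side \<eta>;
  Cauchy-Schwarz then gives the summand. Stating this for coordinates \<open>u\<close> and
  \<open>v\<close> on a probability space lets x and y exchange roles.\<close>

lemma measure_close_power_sums_ge:
  fixes M :: "'w measure" and u v :: "'w \<Rightarrow> real" and k n m :: nat and \<eta> :: real and R :: "nat set"
  defines "Z \<equiv> \<Pi>\<^sub>M l\<in>{..<k}. M" and "I \<equiv> tarry_idx n m"
  assumes M: "prob_space M"
    and uv [measurable]: "u \<in> borel_measurable M" "v \<in> borel_measurable M"
    and uv01: "\<And>w. w \<in> space M \<Longrightarrow> u w \<in> {0..1}" "\<And>w. w \<in> space M \<Longrightarrow> v w \<in> {0..1}"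
    and unif: "\<And>a b. 0 \<le> a \<Longrightarrow> a \<le> b \<Longrightarrow> b \<le> 1 \<Longrightarrow> measure M {w \<in> space M. u w \<in> {a..<b}} = b - a"
    and k: "k \<ge> 1" and R: "finite R" "k \<ge> 2 \<or> card R \<le> 1"
    and \<eta>: "\<eta> > 0" "\<And>r. r \<in> R \<Longrightarrow> \<eta> \<le> (1 / 2 ^ r) ^ n"
  shows "(\<Sum>r\<in>R. (\<eta> / (k + 1)) ^ card I * (2 ^ r) ^ (sum fst I + 1) / (2 ^ (r + 1)) ^ (2 * k))
    \<le> measure (Z \<Otimes>\<^sub>M Z) {z \<in> space (Z \<Otimes>\<^sub>M Z). \<forall>p\<in>I.
        \<bar>(\<Sum>l<k. u (fst z l) ^ fst p * v (fst z l) ^ snd p)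
          - (\<Sum>l<k. u (snd z l) ^ fst p * v (snd z l) ^ snd p)\<bar> \<le> 2 ^ n * \<eta>}"
    (is "?lhs \<le> measure _ ?G")
proof -
  interpret M: prob_space M by fact
  interpret P: finite_product_prob_space "\<lambda>_ :: nat. M" "{..<k}"
    by standard auto
  have Z: "prob_space Z" unfolding Z_def by (rule P.prob_space_axioms)
  have comp [measurable]: "(\<lambda>z. z l) \<in> measurable Z M" if "l < k" for l
    unfolding Z_def using that by (intro measurable_component_singleton) auto
  have fin: "finite I" by (simp add: I_def)
  (* x_0 lies in the left half and all other x_l in the right half: for k >= 2 this makes the
     sets E (r, c) of different scales r disjoint. *)
  define H where "H r c l = (if l = 0 then {real c / 2 ^ r..<(real c + 1 / 2) / 2 ^ r}
    else {(real c + 1 / 2) / 2 ^ r..<(real c + 1) / 2 ^ r})" for r c l :: nat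
  define E where "E = (\<lambda>(r, c). \<Pi>\<^sub>E l\<in>{..<k}. {w \<in> space M. u w \<in> H r c l})"
  define s where "s r c p z = (\<Sum>l<k. (u (z l) - real c / 2 ^ r) ^ fst p * v (z l) ^ snd p)"
    for r c :: nat and p and z :: "nat \<Rightarrow> 'w"
  \<comment> \<open>The label of the cell of side \<eta> that contains the centred power sums; the
    restriction to \<open>I\<close> makes the labels elements of the finite product
    \<open>B r\<close>.\<close>
  define g where "g = (\<lambda>(r, c) z. \<lambda>p\<in>I. \<lfloor>s r c p z / \<eta>\<rfloor>)"
  define B :: "nat \<Rightarrow> (nat \<times> nat \<Rightarrow> int) set"
    where "B r = (\<Pi>\<^sub>E p\<in>I. {0..\<lfloor>k * (1 / 2 ^ r) ^ fst p / \<eta>\<rfloor>})" for r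
  define S where "S = (SIGMA r:R. {..<2 ^ r :: nat})"
  have H_sets: "{w \<in> space M. u w \<in> H r c l} \<in> sets M" for r c l
    by (cases "l = 0") (simp_all add: H_def)
  have E_sets: "E q \<in> sets Z" for q
    unfolding E_def Z_def by (cases q) (auto intro!: sets_PiM_I_finite H_sets)
  have s_meas [measurable]: "s r c p \<in> borel_measurable Z" for r c p
    unfolding s_def by measurable
  have c_le: "real c + 1 \<le> 2 ^ r" if "c < 2 ^ r" for c r :: nat
    using that by (metis Suc_eq_plus1 Suc_leI of_nat_1 of_nat_add of_nat_le_iff of_nat_numeral of_nat_power)
  have E_measure: "measure Z (E (r, c)) = (1 / 2 ^ (r + 1)) ^ k" if "c < 2 ^ r" for r c
  proof -
    \<comment> \<open>Both halves have the same length, so the index 0 contributes the same factor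
      as the others.\<close>
    have "measure M {w \<in> space M. u w \<in> H r c l} = 1 / 2 ^ (r + 1)" for l
    proof (cases "l = 0")
      case True
      have "measure M {w \<in> space M. u w \<in> H r c l} = (real c + 1 / 2) / 2 ^ r - real c / 2 ^ r"
        unfolding H_def if_P[OF True] using c_le[OF that] by (intro unif) (simp_all add: field_simps)
      then show ?thesis by (simp add: field_simps)
    next
      case False
      have "measure M {w \<in> space M. u w \<in> H r c l} = (real c + 1) / 2 ^ r - (real c + 1 / 2) / 2 ^ r"
        unfolding H_def if_not_P[OF False] using c_le[OF that] by (intro unif) (simp_all add: field_simps)
      then show ?thesis by (simp add: field_simps)
    qed
    then show ?thesis
      unfolding E_def Z_def by (simp add: P.prob_times H_sets)
  qed
  have E_bounds: "u (z l) - real c / 2 ^ r \<in> {0..1 / 2 ^ r}" "v (z l) \<in> {0..1}"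
    if "z \<in> E (r, c)" "l < k" for r c z l
  proof -
    have z: "z l \<in> space M" "u (z l) \<in> H r c l" using that by (auto simp: E_def)
    then show "v (z l) \<in> {0..1}" using uv01 by auto
    have "real c / 2 ^ r \<le> u (z l)" "u (z l) < (real c + 1) / 2 ^ r"
      using z(2) by (auto simp: H_def field_simps split: if_splits)
    then show "u (z l) - real c / 2 ^ r \<in> {0..1 / 2 ^ r}"
      by (simp add: add_divide_distrib)
  qed
  have s_bounds: "s r c p z \<in> {0..k * (1 / 2 ^ r) ^ fst p}" if "z \<in> E (r, c)" for r c p z
  proof -
    have t: "(u (z l) - real c / 2 ^ r) ^ fst p * v (z l) ^ snd p \<in> {0..(1 / 2 ^ r) ^ fst p}" if "l < k" for l
    proof -
      have "(u (z l) - real c / 2 ^ r) ^ fst p * v (z l) ^ snd p \<le> (1 / 2 ^ r) ^ fst p * 1"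
        using E_bounds[OF \<open>z \<in> E (r, c)\<close> that] by (intro mult_mono power_mono power_le_one) auto
      then show ?thesis
        using E_bounds[OF \<open>z \<in> E (r, c)\<close> that] by auto
    qed
    have "0 \<le> s r c p z"
      unfolding s_def using t by (intro sum_nonneg) auto
    moreover have "s r c p z \<le> (\<Sum>l<k. (1 / 2 ^ r) ^ fst p)"
      unfolding s_def using t by (intro sum_mono) auto
    ultimately show ?thesis by simp
  qed
  have card_B: "real (card (B r)) \<le> ((k + 1) / \<eta>) ^ card I * (1 / 2 ^ r) ^ sum fst I" if "r \<in> R" for r
  proof -
    have "real (card (B r)) = (\<Prod>p\<in>I. real_of_int (\<lfloor>k * (1 / 2 ^ r) ^ fst p / \<eta>\<rfloor> + 1))"
      unfolding B_def using \<eta> fin by (simp add: card_PiE)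
    also have "\<dots> \<le> (\<Prod>p\<in>I. (k + 1) / \<eta> * (1 / 2 ^ r) ^ fst p)"
    proof (rule prod_mono, rule conjI)
      fix p assume "p \<in> I"
      then have "fst p \<le> n" by (auto simp: I_def tarry_idx_def)
      then have "\<eta> \<le> (1 / 2 ^ r) ^ fst p"
        by (intro order_trans[OF \<eta>(2)[OF that]] power_decreasing) auto
      \<comment> \<open>The box is at least one cell wide up to the factor \<open>k\<close>, so the
        extra cell in the count is absorbed by passing from \<open>k\<close> to
        \<open>k + 1\<close>.\<close>
      then have "1 \<le> (1 / 2 ^ r) ^ fst p / \<eta>" using \<eta> by simp
      then have "k * (1 / 2 ^ r) ^ fst p / \<eta> + 1 \<le> (k + 1) / \<eta> * (1 / 2 ^ r) ^ fst p"
        by (simp add: algebra_simps add_divide_distrib)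
      then show "real_of_int (\<lfloor>k * (1 / 2 ^ r) ^ fst p / \<eta>\<rfloor> + 1) \<le> (k + 1) / \<eta> * (1 / 2 ^ r) ^ fst p"
        using of_int_floor_le[of "k * (1 / 2 ^ r) ^ fst p / \<eta>"] unfolding of_int_add of_int_1 by linarith
      show "0 \<le> real_of_int (\<lfloor>k * (1 / 2 ^ r) ^ fst p / \<eta>\<rfloor> + 1)"
        using \<eta> by simp
    qed
    also have "\<dots> = ((k + 1) / \<eta>) ^ card I * (1 / 2 ^ r) ^ sum fst I"
      by (simp only: prod.distrib prod_constant power_sum)
    finally show ?thesis .
  qed
  \<comment> \<open>The summand is regrouped as the number of intervals times the squared measure of
    \<open>E (r, c)\<close> over the bound for the number of cells.\<close>
  have "?lhs = (\<Sum>r\<in>R. 2 ^ r * (((1 / 2 ^ (r + 1)) ^ k)\<^sup>2 /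
      (((k + 1) / \<eta>) ^ card I * (1 / 2 ^ r) ^ sum fst I)))"
    using \<eta> by (intro sum.cong refl) (simp add: field_simps power_mult power2_eq_square power_mult_distrib)
  also have "\<dots> \<le> (\<Sum>r\<in>R. 2 ^ r * (((1 / 2 ^ (r + 1)) ^ k)\<^sup>2 / card (B r)))"
  proof (intro sum_mono mult_left_mono divide_left_mono card_B)
    fix r assume "r \<in> R"
    have "card (B r) > 0"
      unfolding B_def using \<eta> fin by (subst card_gt_0_iff) (auto simp: PiE_eq_empty_iff intro!: finite_PiE)
    then show "((k + 1) / \<eta>) ^ card I * (1 / 2 ^ r) ^ sum fst I * real (card (B r)) > 0"
      using \<eta> by simp
  qed auto
  also have "\<dots> = (\<Sum>r\<in>R. \<Sum>c<2 ^ r. (measure Z (E (r, c)))\<^sup>2 / card (B r))"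
    by (simp add: E_measure)
  also have "\<dots> = (\<Sum>q\<in>S. (measure Z (E q))\<^sup>2 / card (B (fst q)))"
    unfolding S_def using R by (subst sum.Sigma) (auto simp: case_prod_unfold)
  also have "\<dots> \<le> measure (Z \<Otimes>\<^sub>M Z) ?G"
  proof (rule measure_pair_ge_sum_cells[OF Z, where g = g])
    show "finite S" using R by (simp add: S_def)
    show "disjoint_family_on E S"
    proof -
      have "r = r' \<and> c = c'"
        if q: "(r, c) \<in> S" "(r', c') \<in> S" and z: "z \<in> E (r, c)" "z \<in> E (r', c')" for r c r' c' z
      proof -
        have zH: "u (z l) \<in> H r c l" "u (z l) \<in> H r' c' l" if "l < k" for l
          using z that by (auto simp: E_def)
        have "r = r'"
        \<comment> \<open>Two points in different halves determine the scale; a single point does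
          not, but for \<open>k = 1\<close> the set \<open>R\<close> has at most one
          element.\<close>
        proof (cases "k \<ge> 2")
          case True
          then show ?thesis
            using zH[of 0] zH[of 1] dyadic_split_unique[of "u (z 0)" "real c" r "u (z 1)" "real c'" r']
            by (auto simp: H_def)
        next
          case False
          then have "card R \<le> 1" using R by auto
          then show ?thesis using q R by (auto simp: S_def card_le_Suc0_iff_eq)
        qed
        moreover have "c = c'"
        proof -
          have "real c / 2 ^ r \<le> u (z 0)" "u (z 0) < (real c + 1) / 2 ^ r"
            "real c' / 2 ^ r \<le> u (z 0)" "u (z 0) < (real c' + 1) / 2 ^ r"
            using zH[of 0] k \<open>r = r'\<close> by (auto simp: H_def field_simps)
          then have "real c / 2 ^ r < (real c' + 1) / 2 ^ r" "real c' / 2 ^ r < (real c + 1) / 2 ^ r"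
            by linarith+
          then have "real c < real c' + 1" "real c' < real c + 1"
            by (simp_all add: divide_less_cancel)
          then show ?thesis by linarith
        qed
        ultimately show ?thesis ..
      qed
      then show ?thesis unfolding disjoint_family_on_def by fast
    qed
    show "E q \<in> sets Z" for q by (rule E_sets)
    show "finite (B (fst q))" for q
      unfolding B_def using fin by (intro finite_PiE) auto
    show "g q z \<in> B (fst q)" if "q \<in> S" "z \<in> E q" for q z
      using that s_bounds[of z "fst q" "snd q"] \<eta>
      by (auto simp: g_def B_def intro!: floor_mono divide_right_mono split: prod.splits)
    show "{z \<in> E q. g q z = b} \<in> sets Z" if "b \<in> B (fst q)" for q b
    proof -
      obtain r c where q: "q = (r, c)" by (cases q)
      have "b \<in> extensional I" using that by (auto simp: B_def PiE_def)
      \<comment> \<open>Equality with an extensional label only has to be tested at the finitely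
        many points of \<open>I\<close>, which is a measurable condition.\<close>
      then have "{z \<in> E q. g q z = b} = E q \<inter> {z \<in> space Z. \<forall>p\<in>I. \<lfloor>s r c p z / \<eta>\<rfloor> = b p}"
        using sets.sets_into_space[OF E_sets[of q]]
        by (auto simp: g_def q restrict_def extensional_def fun_eq_iff)
      also have "\<dots> \<in> sets Z"
        using fin by (intro sets.Int E_sets) measurable
      finally show ?thesis .
    qed
    show "?G \<in> sets (Z \<Otimes>\<^sub>M Z)"
      using fin by measurable
    fix q z z' assume "q \<in> S" and z: "z \<in> E q" "z' \<in> E q" and eq: "g q z = g q z'"
    obtain r c where q: "q = (r, c)" by (cases q)
    have c: "real c / 2 ^ r \<le> 1" using \<open>q \<in> S\<close> c_le[of c r] by (auto simp: q S_def)
    have s_close: "\<bar>s r c p z - s r c p z'\<bar> \<le> \<eta>" if "p \<in> I" for p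
    proof -
      have "\<lfloor>s r c p z / \<eta>\<rfloor> = \<lfloor>s r c p z' / \<eta>\<rfloor>"
        using fun_cong[OF eq, of p] that by (simp add: g_def q)
      then have "\<bar>s r c p z / \<eta> - s r c p z' / \<eta>\<bar> \<le> 1" by linarith
      then show ?thesis using \<eta> by (simp add: field_simps abs_le_iff)
    qed
    have "\<bar>(\<Sum>l<k. u (z l) ^ i * v (z l) ^ j) - (\<Sum>l<k. u (z' l) ^ i * v (z' l) ^ j)\<bar> \<le> 2 ^ n * \<eta>"
      if "(i, j) \<in> I" for i j
    proof -
      have "\<bar>(\<Sum>l<k. u (z l) ^ i * v (z l) ^ j) - (\<Sum>l<k. u (z' l) ^ i * v (z' l) ^ j)\<bar> \<le> 2 ^ i * \<eta>"
      proof (rule power_sum_diff_le_shifted[where a = "real c / 2 ^ r"])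
        fix t assume "t \<le> i"
        show "\<bar>(\<Sum>l<k. (u (z l) - real c / 2 ^ r) ^ t * v (z l) ^ j)
          - (\<Sum>l<k. (u (z' l) - real c / 2 ^ r) ^ t * v (z' l) ^ j)\<bar> \<le> \<eta>"
        \<comment> \<open>The pair (0, 0) is missing from \<open>I\<close>, but its power sum is
          \<open>k\<close> for every tuple, so the difference vanishes.\<close>
        proof (cases "t + j = 0")
          case False
          then have "(t, j) \<in> I" using that \<open>t \<le> i\<close> by (auto simp: I_def tarry_idx_def)
          from s_close[OF this] show ?thesis by (simp add: s_def)
        qed (use \<eta> in auto)
      qed (use c in auto)
      also have "\<dots> \<le> 2 ^ n * \<eta>"
        using that \<eta> by (intro mult_right_mono power_increasing) (auto simp: I_def tarry_idx_def)
      finally show ?thesis .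
    qed
    then show "(z, z') \<in> ?G"
      using z sets.sets_into_space[OF E_sets[of q]] by (auto simp: space_pair_measure)
  qed
  finally show ?thesis .
qed

section \<open>Divergence for a general pair of coordinates\<close>

text \<open>The Gaussian bound is applied with \<open>e = 2 * pi * (2 ^ n * \<eta>)\<close>. The
  powers of \<eta> cancel against those from the cells, and the scales in \<open>R\<close>
  contribute at least \<open>L\<close> times a fixed amount, for every \<open>L\<close>. The
  bijection \<pi> renames the coefficients, so that the polynomial with x and y exchanged is covered
  too.\<close>

lemma nn_integral_oscillatory_power_infinite:
  fixes M :: "'w measure" and u v :: "'w \<Rightarrow> real" and k n m :: nat and \<pi> :: "'i \<Rightarrow> nat \<times> nat"
  assumes M: "prob_space M"
    and uv [measurable]: "u \<in> borel_measurable M" "v \<in> borel_measurable M"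
    and uv01: "\<And>w. w \<in> space M \<Longrightarrow> u w \<in> {0..1}" "\<And>w. w \<in> space M \<Longrightarrow> v w \<in> {0..1}"
    and unif: "\<And>a b. 0 \<le> a \<Longrightarrow> a \<le> b \<Longrightarrow> b \<le> 1 \<Longrightarrow> measure M {w \<in> space M. u w \<in> {a..<b}} = b - a"
    and \<pi>: "bij_betw \<pi> J (tarry_idx n m)"
    and k: "k \<ge> 1" "2 * k \<le> sum fst (tarry_idx n m) + 1" "k \<ge> 2 \<or> 2 * k \<le> sum fst (tarry_idx n m)"
  shows "(\<integral>\<^sup>+ \<alpha>. ennreal (cmod (\<integral>w. iexp (2 * pi * (\<Sum>p\<in>J. \<alpha> p * u w ^ fst (\<pi> p) * v w ^ snd (\<pi> p))) \<partial>M) ^ (2 * k))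
    \<partial>(\<Pi>\<^sub>M p\<in>J. lborel)) = \<infinity>" (is "?\<theta> = _")
proof -
  interpret M: prob_space M by fact
  interpret P: finite_product_prob_space "\<lambda>_ :: nat. M" "{..<k}"
    by standard auto
  define Z where "Z = (\<Pi>\<^sub>M l\<in>{..<k}. M)"
  have Z: "prob_space Z" unfolding Z_def by (rule P.prob_space_axioms)
  have comp [measurable]: "(\<lambda>z. z l) \<in> measurable Z M" if "l < k" for l
    unfolding Z_def using that by (intro measurable_component_singleton) auto
  define I where "I = tarry_idx n m"
  define A where "A = sum fst I"
  define N where "N = card I"
  have J: "finite J" "card J = N"
    using bij_betw_finite[OF \<pi>] bij_betw_same_card[OF \<pi>] by (simp_all add: N_def I_def)
  have \<pi>I: "\<pi> ` J = I" using \<pi> by (simp add: bij_betw_def I_def)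
  define \<tau> where "\<tau> q z = (\<Sum>l<k. u (z l) ^ fst q * v (z l) ^ snd q)" for q and z :: "nat \<Rightarrow> 'w"
  have \<tau> [measurable]: "\<tau> q \<in> borel_measurable Z" for q
    unfolding \<tau>_def by measurable
  \<comment> \<open>This is what the Gaussian constant and the cell bound leave once \<eta> has
    cancelled; \<open>4 ^ k\<close> stems from using half-intervals.\<close>
  define c where "c = (sqrt (2 * pi) * exp (- 1 / 2) / (2 * pi * 2 ^ n * (k + 1))) ^ N / 4 ^ k"
  have c: "c > 0" by (simp add: c_def)
  \<comment> \<open>The \<open>k\<close>-th power of an integral is an integral over
    \<open>k\<close> independent copies, in which the phases add up to the power sums \<tau>; the
    remaining square is the one treated by Gaussian averaging.\<close>
  have power: "cmod (\<integral>w. iexp (2 * pi * (\<Sum>p\<in>J. \<alpha> p * u w ^ fst (\<pi> p) * v w ^ snd (\<pi> p))) \<partial>M) ^ (2 * k)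
      = (cmod (\<integral>z. iexp (\<Sum>p\<in>J. \<alpha> p * (2 * pi * \<tau> (\<pi> p) z)) \<partial>Z))\<^sup>2" for \<alpha>
  proof -
    let ?h = "\<lambda>w. 2 * pi * (\<Sum>p\<in>J. \<alpha> p * u w ^ fst (\<pi> p) * v w ^ snd (\<pi> p))"
    have "integrable M (\<lambda>w. iexp (?h w))"
      by (rule M.integrable_const_bound[where B = 1]) auto
    then have "(\<integral>z. (\<Prod>l<k. iexp (?h (z l))) \<partial>Z) = (\<integral>w. iexp (?h w) \<partial>M) ^ k"
      unfolding Z_def by (subst P.product_integral_prod) auto
    moreover have "(\<Prod>l<k. iexp (?h (z l))) = iexp (\<Sum>p\<in>J. \<alpha> p * (2 * pi * \<tau> (\<pi> p) z))" for z
    proof -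
      have "(\<Sum>l<k. ?h (z l)) = (\<Sum>p\<in>J. \<alpha> p * (2 * pi * \<tau> (\<pi> p) z))"
        unfolding \<tau>_def by (simp add: sum_distrib_left mult_ac) (rule sum.swap)
      then show ?thesis by (simp only: iexp_sum[OF finite_lessThan, symmetric])
    qed
    ultimately show ?thesis by (simp add: norm_power power_mult[symmetric] mult.commute)
  qed
  have "ennreal (real L * c) \<le> ?\<theta>" for L
  proof -
    (* For k = 1 the scales overlap, but then 2k <= A and the single scale 2^(-L) suffices. *)
    define R where "R = (if k \<ge> 2 then {..<L} else {L})"
    \<comment> \<open>One cell size has to serve all scales of \<open>R\<close>; since these are at
      most \<open>L\<close>, the \<open>n\<close>-th power of \<open>1 / 2 ^ L\<close> is small
      enough.\<close>
    define \<eta> :: real where "\<eta> = (1 / 2 ^ L) ^ n"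
    have \<eta>: "\<eta> > 0" by (simp add: \<eta>_def)
    have \<eta>_le: "\<eta> \<le> (1 / 2 ^ r) ^ n" if "r \<in> R" for r
      unfolding \<eta>_def using that
      by (intro power_mono divide_left_mono power_increasing) (auto simp: R_def split: if_splits)
    let ?Q = "\<lambda>\<epsilon>. measure (Z \<Otimes>\<^sub>M Z) {z \<in> space (Z \<Otimes>\<^sub>M Z). \<forall>q\<in>I. \<bar>\<tau> q (fst z) - \<tau> q (snd z)\<bar> \<le> \<epsilon>}"
    have four: "((2 ^ (r + 1)) ^ (2 * k) :: real) = 4 ^ k * (2 ^ r) ^ (2 * k)" for r
      using power_mult[of "2 :: real" 2 k] power_mult_distrib[of "2 :: real" "2 ^ r" "2 * k"] by simp
    have "(\<Sum>r\<in>R. (2 ^ r) ^ (A + 1) / (2 ^ (r + 1)) ^ (2 * k)) \<ge> real L / 4 ^ k"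
    proof (cases "k \<ge> 2")
      case True
      have "(2 ^ r) ^ (A + 1) / (2 ^ (r + 1)) ^ (2 * k) \<ge> (1 / 4 ^ k :: real)" for r
      proof -
        \<comment> \<open>Here \<open>2 * k \<le> A + 1\<close> enters: no scale contributes less
          than \<open>1 / 4 ^ k\<close>, however fine it is.\<close>
        have "((2 ^ r) ^ (2 * k) :: real) \<le> (2 ^ r) ^ (A + 1)"
          using k by (intro power_increasing) (auto simp: A_def I_def)
        then show ?thesis unfolding four by (simp add: field_simps)
      qed
      then have "(\<Sum>r\<in>R. (1 / 4 ^ k :: real)) \<le> (\<Sum>r\<in>R. (2 ^ r) ^ (A + 1) / (2 ^ (r + 1)) ^ (2 * k))"
        by (intro sum_mono)
      then show ?thesis using True by (simp add: R_def)
    next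
      case False
      \<comment> \<open>With \<open>2 * k \<le> A\<close> a whole factor \<open>2 ^ L\<close> is
        left over, and it exceeds \<open>L\<close>.\<close>
      have "((2 ^ L) ^ (2 * k) :: real) \<le> (2 ^ L) ^ A"
        using k False by (intro power_increasing) (auto simp: A_def I_def)
      moreover have "real L \<le> 2 ^ L" by simp
      ultimately have "real L * (2 ^ L) ^ (2 * k) \<le> 2 ^ L * (2 ^ L) ^ A"
        by (intro mult_mono) auto
      then show ?thesis using False
        unfolding four by (simp add: R_def field_simps)
    qed
    then have "(\<eta> / (k + 1)) ^ N * (real L / 4 ^ k)
        \<le> (\<Sum>r\<in>R. (\<eta> / (k + 1)) ^ N * (2 ^ r) ^ (A + 1) / (2 ^ (r + 1)) ^ (2 * k))"
      using \<eta> by (simp add: sum_distrib_left[symmetric] mult_left_mono flip: times_divide_eq_right)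
    also have "\<dots> \<le> ?Q (2 ^ n * \<eta>)"
      unfolding \<tau>_def Z_def N_def A_def I_def
      by (rule measure_close_power_sums_ge[OF M uv uv01 unif k(1)])
        (use \<eta> \<eta>_le in \<open>auto simp: R_def\<close>)
    finally have Q: "(\<eta> / (k + 1)) ^ N * (real L / 4 ^ k) \<le> ?Q (2 ^ n * \<eta>)" .
    have "real L * c = (sqrt (2 * pi) * exp (- 1 / 2) / (2 * pi * (2 ^ n * \<eta>))) ^ N *
        ((\<eta> / (k + 1)) ^ N * (real L / 4 ^ k))"
      using \<eta> by (simp add: c_def power_mult_distrib power_divide mult_ac)
    also have "\<dots> \<le> (sqrt (2 * pi) * exp (- 1 / 2) / (2 * pi * (2 ^ n * \<eta>))) ^ card J *
        measure (Z \<Otimes>\<^sub>M Z) {z \<in> space (Z \<Otimes>\<^sub>M Z). \<forall>p\<in>J.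
          \<bar>2 * pi * \<tau> (\<pi> p) (fst z) - 2 * pi * \<tau> (\<pi> p) (snd z)\<bar> \<le> 2 * pi * (2 ^ n * \<eta>)}"
      using Q \<eta> unfolding J \<pi>I[symmetric]
      by (intro mult_left_mono) (simp_all add: abs_mult flip: right_diff_distrib)
    finally have "ennreal (real L * c) \<le> ennreal \<dots>" by (rule ennreal_leI)
    also have "\<dots> \<le> ?\<theta>"
      unfolding power using \<eta> by (intro nn_integral_oscillatory_square_ge J Z) auto
    finally show ?thesis .
  qed
  then have *: "ennreal (real L * c) \<le> ?\<theta>" for L .
  show ?thesis
  proof (rule ccontr)
    assume "?\<theta> \<noteq> \<infinity>"
    then obtain x where x: "?\<theta> = ennreal x" "x \<ge> 0" by (cases ?\<theta>) auto
    obtain L :: nat where "x / c < real L" using reals_Archimedean2 by blast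
    then show False using *[of L] x c by (simp add: field_simps)
  qed
qed

section \<open>The exponent and the unit square\<close>

text \<open>Each \<open>i\<close> occurs with \<open>m + 1\<close> values of \<open>j\<close>, and
  the excluded pair (0, 0) would add 0. The sum is the exponent of the box volume, doubled to avoid
  division of natural numbers.\<close>

lemma sum_fst_tarry_idx: "2 * sum fst (tarry_idx n m) = (m + 1) * (n * (n + 1))"
proof -
  have "sum fst (tarry_idx n m) = sum fst ({0..n} \<times> {0..m})"
    unfolding tarry_idx_eq by (simp add: sum_diff1_nat)
  also have "\<dots> = (m + 1) * \<Sum>{0..n}"
    by (simp add: sum.cartesian_product[symmetric] sum_distrib_left case_prod_unfold[symmetric] fst_def)
  finally show ?thesis using gauss_sum_nat[of n] by simp
qed

theorem theorem1:
  fixes n m k :: nat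
  assumes "n \<ge> 1" and "m \<ge> 1"
    and "4 * real k \<le> 2 + (real n + real m) * (real n + 1) * (real m + 1) / 2"
  shows "tarry_theta n m k = \<infinity>"
proof (cases "k = 0")
  \<comment> \<open>For \<open>k = 0\<close> the integrand is 1, and the integral is the Lebesgue
    measure of a real space of positive dimension.\<close>
  case True
  interpret L: product_sigma_finite "\<lambda>_ :: nat \<times> nat. lborel :: real measure" ..
  have "(1, 0) \<in> tarry_idx n m" using assms by (auto simp: tarry_idx_def)
  then have "card (tarry_idx n m) > 0" by (auto simp: card_gt_0_iff)
  then have "emeasure (\<Pi>\<^sub>M p\<in>tarry_idx n m. lborel) (\<Pi>\<^sub>E p\<in>tarry_idx n m. UNIV :: real set) = \<infinity>"
    by (subst L.emeasure_PiM) auto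
  then show ?thesis by (simp add: tarry_theta_def True space_PiM)
next
  case False
  define Q where "Q = restrict_space lborel {0..1 :: real}"
  interpret Q: prob_space Q
    by standard (simp add: Q_def space_restrict_space emeasure_restrict_space)
  have QQ: "prob_space (Q \<Otimes>\<^sub>M Q)" by (intro prob_space_pair Q.prob_space_axioms)
  interpret QQ: prob_space "Q \<Otimes>\<^sub>M Q" by (rule QQ)
  interpret QP: pair_sigma_finite Q Q ..
  have space_Q: "space Q = {0..1}" by (simp add: Q_def space_restrict_space)
  have id_meas: "(\<lambda>x. x) \<in> borel_measurable Q"
    unfolding Q_def by (intro measurable_restrict_space1) simp
  have meas: "fst \<in> borel_measurable (Q \<Otimes>\<^sub>M Q)" "snd \<in> borel_measurable (Q \<Otimes>\<^sub>M Q)"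
    by (rule measurable_compose[OF measurable_fst id_meas], rule measurable_compose[OF measurable_snd id_meas])
  note meas[measurable]
  have range: "fst w \<in> {0..1}" "snd w \<in> {0..1}" if "w \<in> space (Q \<Otimes>\<^sub>M Q)" for w
    using that by (auto simp: space_pair_measure space_Q)
  have Q_ivl: "{a..<b} \<in> sets Q" "measure Q {a..<b} = b - a" if "0 \<le> a" "a \<le> b" "b \<le> 1" for a b :: real
  proof -
    have *: "{a..<b} \<subseteq> {0..1}" using that by auto
    then show "{a..<b} \<in> sets Q" by (simp add: Q_def sets_restrict_space_iff)
    show "measure Q {a..<b} = b - a"
      unfolding Q_def using * that by (subst measure_restrict_space) auto
  qed
  have unif: "measure (Q \<Otimes>\<^sub>M Q) {w \<in> space (Q \<Otimes>\<^sub>M Q). fst w \<in> {a..<b}} = b - a"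
    "measure (Q \<Otimes>\<^sub>M Q) {w \<in> space (Q \<Otimes>\<^sub>M Q). snd w \<in> {a..<b}} = b - a"
    if "0 \<le> a" "a \<le> b" "b \<le> 1" for a b :: real
  proof -
    have "{w \<in> space (Q \<Otimes>\<^sub>M Q). fst w \<in> {a..<b}} = {a..<b} \<times> space Q"
      "{w \<in> space (Q \<Otimes>\<^sub>M Q). snd w \<in> {a..<b}} = space Q \<times> {a..<b}"
      using that by (auto simp: space_pair_measure space_Q)
    then show "measure (Q \<Otimes>\<^sub>M Q) {w \<in> space (Q \<Otimes>\<^sub>M Q). fst w \<in> {a..<b}} = b - a"
      "measure (Q \<Otimes>\<^sub>M Q) {w \<in> space (Q \<Otimes>\<^sub>M Q). snd w \<in> {a..<b}} = b - a"
      using Q_ivl[OF that] Q.emeasure_pair_measure_Times[of "{a..<b}" Q "space Q"]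
        Q.emeasure_pair_measure_Times[of "space Q" Q "{a..<b}"] Q.emeasure_space_1
      by (simp_all add: measure_def)
  qed
  \<comment> \<open>The first component of \<open>w\<close> is the outer variable y, so x is
    \<open>snd w\<close>.\<close>
  have osc: "tarry_osc n m \<alpha> = (\<integral>w. iexp (2 * pi * tarry_poly n m \<alpha> (snd w) (fst w)) \<partial>(Q \<Otimes>\<^sub>M Q))" for \<alpha>
  proof -
    have "tarry_osc n m \<alpha> = (\<integral>y. \<integral>x. iexp (2 * pi * tarry_poly n m \<alpha> x y) \<partial>Q \<partial>Q)"
      unfolding tarry_osc_def Q_def by (simp add: integral_restrict_space set_lebesgue_integral_def mult_ac)
    also have "\<dots> = (\<integral>w. iexp (2 * pi * tarry_poly n m \<alpha> (snd w) (fst w)) \<partial>(Q \<Otimes>\<^sub>M Q))"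
    proof (subst QP.integral_fst'[symmetric])
      have "(\<lambda>w. tarry_poly n m \<alpha> (snd w) (fst w)) \<in> borel_measurable (Q \<Otimes>\<^sub>M Q)"
        unfolding tarry_poly_def case_prod_unfold by measurable
      then show "integrable (Q \<Otimes>\<^sub>M Q) (\<lambda>w. iexp (2 * pi * tarry_poly n m \<alpha> (snd w) (fst w)))"
        by (intro QQ.integrable_const_bound[where B = 1]) auto
    qed simp
    finally show ?thesis .
  qed
  have small: "2 * k \<le> sum fst (tarry_idx n' m') + 1" "k \<ge> 2 \<or> 2 * k \<le> sum fst (tarry_idx n' m')"
    if "m' \<le> n'" "m' \<ge> 1" "4 * real k \<le> 2 + (real n' + real m') * (real n' + 1) * (real m' + 1) / 2"
    for n' m'
  proof -
    let ?A = "sum fst (tarry_idx n' m')"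
    have A: "2 * real ?A = (real m' + 1) * (real n' * (real n' + 1))"
      using arg_cong[OF sum_fst_tarry_idx[of n' m'], of real] by (simp only: of_nat_mult of_nat_add) simp
    \<comment> \<open>Replacing \<open>m'\<close> by the larger \<open>n'\<close> in the first
      factor weakens the hypothesis to \<open>4 * k \<le> 2 + 2 * ?A\<close>.\<close>
    have "(real n' + real m') * ((real n' + 1) * (real m' + 1)) \<le> 2 * real n' * ((real n' + 1) * (real m' + 1))"
      using that by (intro mult_right_mono) auto
    then have "(real n' + real m') * (real n' + 1) * (real m' + 1) \<le> 2 * (2 * real ?A)"
      unfolding A by (simp only: mult_ac)
    then have "4 * real k \<le> 2 + 2 * real ?A" using that(3) by linarith
    then show "2 * k \<le> ?A + 1" by linarith
    \<comment> \<open>This yields \<open>?A \<ge> 2\<close>, so that for \<open>k = 1\<close> even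
      \<open>2 * k \<le> ?A\<close> holds.\<close>
    have "2 * (1 * 2) \<le> (m' + 1) * (n' * (n' + 1))"
      using that by (intro mult_mono) auto
    then have "2 * (1 * 2) \<le> 2 * ?A" by (simp only: sum_fst_tarry_idx)
    then have "?A \<ge> 2" by simp
    then show "k \<ge> 2 \<or> 2 * k \<le> ?A" by linarith
  qed
  show ?thesis
  proof (cases "m \<le> n")
    case True
    have "bij_betw id (tarry_idx n m) (tarry_idx n m)" by simp
    from nn_integral_oscillatory_power_infinite[OF QQ meas(2,1) range(2,1) unif(2) this _ small[OF True assms(2,3)]]
    show ?thesis
      using False unfolding tarry_theta_def osc tarry_poly_def case_prod_unfold by simp
  next
    case False
    \<comment> \<open>When \<open>m > n\<close>, y is the coordinate to be cut into dyadic
      intervals; it takes the role of \<open>u\<close>, and the exponents are swapped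
      accordingly.\<close>
    have "bij_betw prod.swap (tarry_idx n m) (tarry_idx m n)"
      by (rule bij_betwI[where g = prod.swap]) (auto simp: tarry_idx_def)
    from nn_integral_oscillatory_power_infinite[OF QQ meas range unif(1) this _ small]
    show ?thesis
      using False \<open>k \<noteq> 0\<close> assms unfolding tarry_theta_def osc tarry_poly_def case_prod_unfold
      by (simp add: mult_ac add_ac)
  qed
qed

end
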